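(* Let $p$ be an odd prime with $p\neq 5$. Then $E_{Q_p,\mathbf 1}=p+2$.
   Context: For an odd prime $p$, $\mathbb Z_p=\mathbb Z/p\mathbb Z$, $U(p)$ is its group of units, and $Q_p=\{x^2:x\in U(p)\}$. A sequence of length $k$ in $\mathbb Z_p$ is an element of $\mathbb Z_p^k$. A sequence $(x_1,\ldots,x_k)$ in $\mathbb Z_p$ is called a $(Q_p,\mathbf 1)$-weighted zero-sum sequence if there exist $a_1,\ldots,a_k\in Q_p$ such that $a_1x_1+\cdots+a_kx_k=0$ and $a_1+\cdots+a_k=0$ in $\mathbb Z_p$. The constant $E_{Q_p,\mathbf 1}$ is the least positive integer $k$ such that every sequence in $\mathbb Z_p$ of length $k$ has a $(Q_p,\mathbf 1)$-weighted zero-sum subsequence of length $p$ (terms not necessarily consecutive). *)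

theory Defs
  imports "HOL-Number_Theory.Residues" "HOL-Library.Sublist"
begin

definition unit_squares :: "nat \<Rightarrow> int set" where
  "unit_squares p =
     {x \<otimes>\<^bsub>residue_ring (int p)\<^esub> x | x. x \<in> Units (residue_ring (int p))}"

definition Q_one_weighted_zero_sum :: "nat \<Rightarrow> int list \<Rightarrow> bool" where
  "Q_one_weighted_zero_sum p xs \<longleftrightarrow>
     (\<exists>as. length as = length xs \<and> set as \<subseteq> unit_squares p \<and>
       (\<Oplus>\<^bsub>residue_ring (int p)\<^esub>i\<in>{..<length xs}. as ! i \<otimes>\<^bsub>residue_ring (int p)\<^esub> xs ! i)
          = \<zero>\<^bsub>residue_ring (int p)\<^esub> \<and>
       (\<Oplus>\<^bsub>residue_ring (int p)\<^esub>i\<in>{..<length xs}. as ! i) = \<zero>\<^bsub>residue_ring (int p)\<^esub>)"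

(* For p > 1 some k has the property, so LEAST is meaningful: a sequence of length p^2 has a
   constant subsequence of length p, for which all weights can be taken to be 1. *)
definition E_Q_one :: "nat \<Rightarrow> nat" where
  "E_Q_one p =
     (LEAST k. 0 < k \<and>
       (\<forall>xs. length xs = k \<and> set xs \<subseteq> carrier (residue_ring (int p)) \<longrightarrow>
         (\<exists>ys. subseq ys xs \<and> length ys = p \<and> Q_one_weighted_zero_sum p ys)))"

end

theory Submission
  imports Defs
begin

text \<open>The sequence \<open>0, \<dots>, 0, 1, y\<close> with \<open>p - 1\<close> zeros and \<open>-y\<close> a nonresidue gives the lower bound.
  For the upper bound with \<open>p > 5\<close>, note that weights summing to zero make the problem translation
  invariant, and that for \<open>p > 5\<close> two unit coefficients represent every unit, and three represent
  everything, with unit square weights. If some value occurs three times, translate it to \<open>0\<close>: the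
  other terms absorb the weighted sum and the repeated terms absorb the sum of the weights. If not,
  by pigeonhole two different values occur twice each, and these two pairs absorb both equations.\<close>

section \<open>Diagonal quadratic forms modulo a prime\<close>

lemma ex_inverse_mod_prime:
  fixes p a :: int
  assumes "prime p" and "\<not> p dvd a"
  obtains b where "p dvd a * b - 1"
proof -
  have "coprime a p"
    using assms prime_imp_coprime coprime_commute by blast
  then show thesis
    using that cong_solve_coprime_int by (auto simp: cong_iff_dvd_diff)
qed

text \<open>Apart from 2, these are the gaps met below between squares or fourth powers of 1, 2, 3:
  3 = 4 - 1, 5 = 9 - 4, 8 = 9 - 1 and 15 = 16 - 1.\<close>

lemma not_prime_dvd_numeral:
  fixes p :: int
  assumes "prime p" and "p > 5"
  shows "\<not> p dvd 2" "\<not> p dvd 3" "\<not> p dvd 15" "\<not> p dvd 5" "\<not> p dvd 8"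
proof -
  show 2: "\<not> p dvd 2" and 3: "\<not> p dvd 3" and 5: "\<not> p dvd 5"
    using assms by (auto dest: zdvd_imp_le)
  show "\<not> p dvd 15"
    using prime_dvd_mult_iff[OF assms(1), of 3 5] 3 5 by simp
  show "\<not> p dvd 8"
    using prime_dvd_mult_iff[OF assms(1), of 2 4] prime_dvd_mult_iff[OF assms(1), of 2 2] 2 by simp
qed

text \<open>Pigeonhole: each side of \<open>x a\<^sup>2 = c - y b\<^sup>2\<close> takes \<open>(p + 1) / 2\<close> values modulo \<open>p\<close>.\<close>

lemma ex_binary_square_sum:
  fixes p x y c :: int
  assumes p: "prime p" "odd p" and x: "\<not> p dvd x" and y: "\<not> p dvd y"
  obtains a b where "p dvd x * a\<^sup>2 + y * b\<^sup>2 - c"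
proof -
  define H where "H = {0..p div 2}"
  define f where "f a = (x * a\<^sup>2) mod p" for a
  define g where "g b = (c - y * b\<^sup>2) mod p" for b
  have p0: "p > 0" using p prime_gt_0_int by blast
  \<comment> \<open>Up to sign, \<open>H\<close> contains every residue exactly once. As p is odd,
    \<open>a + b\<close> is at most p - 1, so p can divide it only if a = b = 0.\<close>
  have sq: "a = b" if "a \<in> H" "b \<in> H" "p dvd a\<^sup>2 - b\<^sup>2" for a b
  proof -
    have "p dvd (a - b) * (a + b)"
      using that(3) by (simp add: power2_eq_square algebra_simps)
    then consider "p dvd a - b" | "p dvd a + b"
      using p by (auto simp: prime_dvd_mult_iff)
    then show ?thesis
    proof cases
      case 1
      moreover have "\<bar>a - b\<bar> < p" using that(1,2) p0 by (auto simp: H_def)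
      ultimately show ?thesis using zdvd_imp_le[of p "\<bar>a - b\<bar>"] by (cases "a = b") auto
    next
      case 2
      moreover have "a + b < p" using that(1,2) p p0 by (auto simp: H_def elim!: oddE)
      ultimately show ?thesis using zdvd_imp_le[of p "a + b"] that(1,2) by (force simp: H_def)
    qed
  qed
  have f: "inj_on f H"
  proof (rule inj_onI)
    fix a b assume ab: "a \<in> H" "b \<in> H" "f a = f b"
    then have "p dvd x * (a\<^sup>2 - b\<^sup>2)"
      by (simp add: f_def mod_eq_dvd_iff algebra_simps)
    then show "a = b" using sq ab x p by (auto simp: prime_dvd_mult_iff)
  qed
  have g: "inj_on g H"
  proof (rule inj_onI)
    fix a b assume ab: "a \<in> H" "b \<in> H" "g a = g b"
    then have "p dvd y * (b\<^sup>2 - a\<^sup>2)"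
      by (simp add: g_def mod_eq_dvd_iff algebra_simps)
    then show "a = b" using sq ab y p by (metis prime_dvd_mult_iff)
  qed
  have "f ` H \<inter> g ` H \<noteq> {}"
  proof
    assume "f ` H \<inter> g ` H = {}"
    then have "card (f ` H \<union> g ` H) = card H + card H"
      by (subst card_Un_disjoint) (auto simp: H_def card_image f[unfolded H_def] g[unfolded H_def])
    moreover have "card (f ` H \<union> g ` H) \<le> card {0..<p}"
      by (rule card_mono) (auto simp: f_def g_def p0)
    ultimately show False using p p0 by (auto simp: H_def elim!: oddE)
  qed
  then obtain a b where "f a = g b" by blast
  then have "p dvd x * a\<^sup>2 - (c - y * b\<^sup>2)" by (simp add: f_def g_def mod_eq_dvd_iff)
  then show thesis using that by (simp add: algebra_simps)
qed

text \<open>A line of slope \<open>t\<close> through the point \<open>(a, 0)\<close> meets the conic again in a point without zero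
  coordinates, unless \<open>x\<^sup>2 = y\<^sup>2 t\<^sup>4\<close>, which cannot hold both for \<open>t = 1\<close> and for \<open>t = 2\<close>.\<close>

lemma conic_point_off_axes:
  fixes p x y a :: int
  assumes p: "prime p" "p > 5" and x: "\<not> p dvd x" and y: "\<not> p dvd y" and a: "\<not> p dvd a"
  obtains u v where "\<not> p dvd u" "\<not> p dvd v" "p dvd x * u\<^sup>2 + y * v\<^sup>2 - x * a\<^sup>2"
proof -
  have "\<exists>t\<in>{1, 2}. \<not> p dvd x\<^sup>2 - y\<^sup>2 * t ^ 4"
  proof (rule ccontr)
    assume "\<not> ?thesis"
    then have "p dvd x\<^sup>2 - y\<^sup>2" "p dvd x\<^sup>2 - y\<^sup>2 * 16" by auto
    from dvd_diff[OF this] have "p dvd 15 * (y * y)" by (simp add: power2_eq_square)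
    then show False using p y not_prime_dvd_numeral[OF p] by (simp add: prime_dvd_mult_iff)
  qed
  then obtain t where t: "t = 1 \<or> t = 2" and nd: "\<not> p dvd x\<^sup>2 - y\<^sup>2 * t ^ 4" by blast
  have tu: "\<not> p dvd t" using t not_prime_dvd_numeral[OF p] p by auto
  \<comment> \<open>The line v = t (u + a) meets the conic x u^2 + y v^2 = x a^2 at (-a, 0) and
    again at u = a F / E, v = 2 a x t / E. The inverse \<open>D\<close> of \<open>E\<close> modulo p
    replaces the division.\<close>
  define E where "E = x + y * t\<^sup>2"
  define F where "F = x - y * t\<^sup>2"
  have "E * F = x\<^sup>2 - y\<^sup>2 * t ^ 4" by (simp add: E_def F_def power2_eq_square power4_eq_xxxx algebra_simps)
  then have EF: "\<not> p dvd E" "\<not> p dvd F" using nd by (metis dvd_mult2, metis dvd_mult)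
  obtain D where D: "p dvd E * D - 1" using ex_inverse_mod_prime[OF p(1) EF(1)] .
  have Du: "\<not> p dvd D"
    using D p(1) by (metis dvd_diff_right_iff dvd_mult not_prime_unit)
  have "x * (a * F * D)\<^sup>2 + y * (2 * a * x * t * D)\<^sup>2 - x * a\<^sup>2 = (E * D - 1) * ((E * D + 1) * (x * a\<^sup>2))"
    unfolding E_def F_def by (simp add: power2_eq_square algebra_simps)
  then have "p dvd x * (a * F * D)\<^sup>2 + y * (2 * a * x * t * D)\<^sup>2 - x * a\<^sup>2" using D by simp
  moreover have "\<not> p dvd a * F * D" using p a EF Du by (simp add: prime_dvd_mult_iff)
  moreover have "\<not> p dvd 2 * a * x * t * D"
    using p a x tu Du not_prime_dvd_numeral[OF p] by (simp add: prime_dvd_mult_iff)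
  ultimately show thesis using that by blast
qed

text \<open>Pigeonhole gives a solution with possibly zero coordinates. They cannot both vanish, as
  c is a unit; if one does, c is x or y times a unit square, and the conic has another point off the
  axes. The bound on p matters: modulo 5 the form u^2 + v^2 takes only the values 0, 2, 3 at
  units.\<close>

lemma ex_binary_unit_square_sum:
  fixes p x y c :: int
  assumes p: "prime p" "p > 5" and x: "\<not> p dvd x" and y: "\<not> p dvd y" and c: "\<not> p dvd c"
  obtains u v where "\<not> p dvd u" "\<not> p dvd v" "p dvd x * u\<^sup>2 + y * v\<^sup>2 - c"
proof -
  have "odd p" using p prime_odd_int by auto
  then obtain a b where ab: "p dvd x * a\<^sup>2 + y * b\<^sup>2 - c"
    using ex_binary_square_sum[OF p(1) _ x y] by blast
  consider "\<not> p dvd a" "\<not> p dvd b" | "\<not> p dvd a" "p dvd b" | "p dvd a" "\<not> p dvd b" | "p dvd a" "p dvd b"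
    by blast
  then show thesis
  proof cases
    case 1
    then show ?thesis using that ab by blast
  next
    case 2
    from 2 have "p dvd y * b\<^sup>2" by (simp add: power2_eq_square)
    from dvd_diff[OF ab this] have *: "p dvd x * a\<^sup>2 - c" by (simp add: algebra_simps)
    obtain u v where "\<not> p dvd u" "\<not> p dvd v" "p dvd x * u\<^sup>2 + y * v\<^sup>2 - x * a\<^sup>2"
      using conic_point_off_axes[OF p x y 2(1)] .
    moreover from dvd_add[OF this(3) *] have "p dvd x * u\<^sup>2 + y * v\<^sup>2 - c"
      by (simp only: diff_add_cancel add_diff_eq)
    ultimately show ?thesis using that by blast
  next
    case 3
    from 3 have "p dvd x * a\<^sup>2" by (simp add: power2_eq_square)
    from dvd_diff[OF ab this] have *: "p dvd y * b\<^sup>2 - c" by (simp add: algebra_simps)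
    obtain u v where "\<not> p dvd u" "\<not> p dvd v" "p dvd y * u\<^sup>2 + x * v\<^sup>2 - y * b\<^sup>2"
      using conic_point_off_axes[OF p y x 3(2)] .
    moreover from dvd_add[OF this(3) *] have "p dvd y * u\<^sup>2 + x * v\<^sup>2 - c"
      by (simp only: diff_add_cancel add_diff_eq)
    then have "p dvd x * v\<^sup>2 + y * u\<^sup>2 - c" by (subst add.commute)
    ultimately show ?thesis using that by blast
  next
    case 4
    then have "p dvd x * a\<^sup>2 + y * b\<^sup>2" by (simp add: power2_eq_square)
    from dvd_diff[OF this ab] have "p dvd c" by simp
    with c show ?thesis by simp
  qed
qed

text \<open>A third variable removes the need for c to be a unit. Its value \<open>w\<close> is 1 or
  2, and the two remainders differ by 3 times a unit, so one of them is a unit and can be left to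
  the binary form. All further terms get weight 1.\<close>

lemma ex_unit_square_sum:
  fixes p c :: int and x :: "'a \<Rightarrow> int"
  assumes p: "prime p" "p > 5" and I: "finite I" "card I \<ge> 3" and x: "\<And>i. i \<in> I \<Longrightarrow> \<not> p dvd x i"
  obtains u where "\<And>i. \<not> p dvd u i" "p dvd (\<Sum>i\<in>I. (u i)\<^sup>2 * x i) - c"
proof -
  obtain T where T: "T \<subseteq> I" "card T = 3" using obtain_subset_with_card_n[OF I(2)] by blast
  then obtain i j k where ijk: "T = {i, j, k}" "i \<noteq> j" "i \<noteq> k" "j \<noteq> k"
    by (auto simp: card_3_iff)
  define R where "R = I - {i, j, k}"
  have I_eq: "I = insert i (insert j (insert k R))" and R: "finite R" "i \<notin> R" "j \<notin> R" "k \<notin> R"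
    using T ijk I by (auto simp: R_def)
  have xu: "\<not> p dvd x i" "\<not> p dvd x j" "\<not> p dvd x k" using x by (auto simp: I_eq)
  have "\<exists>w\<in>{1, 2}. \<not> p dvd c - sum x R - x k * w\<^sup>2"
  proof (rule ccontr)
    assume "\<not> ?thesis"
    then have "p dvd c - sum x R - x k * 4" "p dvd c - sum x R - x k" by auto
    from dvd_diff[OF this] have "p dvd - (3 * x k)" by simp
    then have "p dvd 3 * x k" by simp
    then show False using p xu not_prime_dvd_numeral[OF p] by (simp add: prime_dvd_mult_iff)
  qed
  then obtain w where w: "w = 1 \<or> w = 2" "\<not> p dvd c - sum x R - x k * w\<^sup>2" by blast
  have wu: "\<not> p dvd w" using w(1) not_prime_dvd_numeral[OF p] p by auto
  obtain a b where ab: "\<not> p dvd a" "\<not> p dvd b" "p dvd x i * a\<^sup>2 + x j * b\<^sup>2 - (c - sum x R - x k * w\<^sup>2)"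
    using ex_binary_unit_square_sum[OF p xu(1,2) w(2)] .
  define u where "u l = (if l = i then a else if l = j then b else if l = k then w else 1)" for l
  have "(\<Sum>l\<in>R. (u l)\<^sup>2 * x l) = sum x R"
    using R by (intro sum.cong) (auto simp: u_def)
  then have "(\<Sum>l\<in>I. (u l)\<^sup>2 * x l) = a\<^sup>2 * x i + (b\<^sup>2 * x j + (w\<^sup>2 * x k + sum x R))"
    unfolding I_eq using ijk R by (simp add: u_def)
  then have "(\<Sum>l\<in>I. (u l)\<^sup>2 * x l) - c = x i * a\<^sup>2 + x j * b\<^sup>2 - (c - sum x R - x k * w\<^sup>2)"
    by (simp add: algebra_simps)
  moreover have "\<not> p dvd u l" for l using ab wu p by (auto simp: u_def)
  ultimately show thesis using that ab(3) by metis
qed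

section \<open>Indexed families\<close>

text \<open>Writing the weights as squares of integers prime to p turns both equations into
  divisibilities of integers. With a set of indices, choosing a subsequence is choosing a
  subset.\<close>

definition square_zero_sum :: "int \<Rightarrow> ('a \<Rightarrow> int) \<Rightarrow> 'a set \<Rightarrow> bool" where
  "square_zero_sum p x I \<longleftrightarrow>
     (\<exists>u. (\<forall>i\<in>I. \<not> p dvd u i) \<and> p dvd (\<Sum>i\<in>I. (u i)\<^sup>2) \<and> p dvd (\<Sum>i\<in>I. (u i)\<^sup>2 * x i))"

text \<open>Shifting all terms by c changes the weighted sum by c times the sum of the weights,
  which p divides. Any convenient value can thus serve as origin.\<close>

lemma square_zero_sum_translate:
  assumes "\<And>i. i \<in> I \<Longrightarrow> \<not> p dvd u i" and "p dvd (\<Sum>i\<in>I. (u i)\<^sup>2)"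
    and "p dvd (\<Sum>i\<in>I. (u i)\<^sup>2 * (x i - c))"
  shows "square_zero_sum p x I"
proof -
  have "(\<Sum>i\<in>I. (u i)\<^sup>2 * x i) = (\<Sum>i\<in>I. (u i)\<^sup>2 * (x i - c)) + (\<Sum>i\<in>I. (u i)\<^sup>2) * c"
    by (simp add: sum_distrib_right sum.distrib[symmetric] flip: distrib_left)
  then show ?thesis using assms unfolding square_zero_sum_def by (auto intro!: exI[of _ u])
qed

lemma square_zero_sum_const:
  assumes "prime (int p)" and "card I = p" and "\<And>i. i \<in> I \<Longrightarrow> x i = c"
  shows "square_zero_sum (int p) x I"
proof (rule square_zero_sum_translate[where u = "\<lambda>_. 1"])
  show "\<And>i. \<not> int p dvd 1" using assms(1) by auto
qed (use assms in auto)

section \<open>The upper bound through repeated values\<close>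

lemma not_dvd_diff_residues:
  fixes p a b :: int
  assumes "a \<in> {0..<p}" "b \<in> {0..<p}" "a \<noteq> b"
  shows "\<not> p dvd a - b"
  using assms by (auto simp: mod_eq_dvd_iff[symmetric])

lemma square_zero_sum_triple:
  fixes p :: nat and x :: "'a \<Rightarrow> int"
  assumes p: "prime p" "p > 5" and J: "finite J" "card J = p + 2" and x: "x ` J \<subseteq> {0..<int p}"
    and Z: "card {i \<in> J. x i = v} \<ge> 3"
  shows "\<exists>I\<subseteq>J. card I = p \<and> square_zero_sum (int p) x I"
proof -
  define Z where "Z = {i \<in> J. x i = v}"
  have pp: "prime (int p)" "int p > 5" using p by auto
  have fin: "finite Z" "finite (J - Z)" using J by (auto simp: Z_def)
  have ZJ: "Z \<subseteq> J" by (auto simp: Z_def)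
  show ?thesis
  proof (cases "card Z \<ge> p")
    case True
    then obtain I where I: "I \<subseteq> Z" "card I = p" using obtain_subset_with_card_n by metis
    then have "square_zero_sum (int p) x I"
      using pp by (intro square_zero_sum_const[where c = v]) (auto simp: Z_def)
    then show ?thesis using I ZJ by blast
  next
    case False
    \<comment> \<open>At most p - 1 of the p + 2 terms equal \<open>v\<close>, so at least three
      others remain. Three terms on each side are what the ternary representation needs.\<close>
    then have "card (J - Z) \<ge> 3" using J fin ZJ by (simp add: card_Diff_subset)
    then obtain S where S: "S \<subseteq> J - Z" "card S = 3" using obtain_subset_with_card_n by metis
    obtain T where T: "T \<subseteq> Z" "card T = 3" using Z obtain_subset_with_card_n unfolding Z_def by metis
    have "finite S" "finite T" using S T fin by (auto intro: finite_subset)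
    \<comment> \<open>The six chosen indices fit into a set of size p because p > 5.\<close>
    then have "card (S \<union> T) \<le> p" using card_Un_le[of S T] S T p by simp
    then obtain I where I: "S \<union> T \<subseteq> I" "I \<subseteq> J" "card I = p"
      using exists_subset_between[of "S \<union> T" p J] J S T ZJ by auto
    have fI: "finite I" using I J finite_subset by blast
    have c: "card (I - Z) \<ge> 3" "card (I \<inter> Z) \<ge> 3"
      using card_mono[of "I - Z" S] card_mono[of "I \<inter> Z" T] I S T fI by auto
    have nd: "\<not> int p dvd x i - v" if "i \<in> I - Z" for i
    proof
      assume d: "int p dvd x i - v"
      obtain j where "j \<in> Z" using T by (metis card.empty zero_neq_numeral subset_empty subsetI)
      then have "v \<in> x ` J" "x i \<in> x ` J" "x i \<noteq> v" using that I by (auto simp: Z_def)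
      then show False using d x not_dvd_diff_residues by blast
    qed
    \<comment> \<open>With origin \<open>v\<close> the terms in \<open>Z\<close> vanish, so the
      others alone must make the weighted sum zero. The weights on \<open>Z\<close> are then free to
      cancel the sum of the other weights.\<close>
    obtain f where f: "\<And>i. \<not> int p dvd f i" "int p dvd (\<Sum>i\<in>I - Z. (f i)\<^sup>2 * (x i - v)) - 0"
      using ex_unit_square_sum[OF pp _ c(1), of "\<lambda>i. x i - v" 0] nd fI by blast
    obtain g where g: "\<And>i. \<not> int p dvd g i"
      "int p dvd (\<Sum>i\<in>I \<inter> Z. (g i)\<^sup>2 * 1) - (- (\<Sum>i\<in>I - Z. (f i)\<^sup>2))"
      using ex_unit_square_sum[OF pp _ c(2), of "\<lambda>_. 1"] fI pp by (metis finite_Int not_prime_unit)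
    define u where "u i = (if i \<in> Z then g i else f i)" for i
    have split: "sum h I = sum h (I \<inter> Z) + sum h (I - Z)" for h :: "'a \<Rightarrow> int"
      using sum.Int_Diff[OF fI] .
    have "(\<Sum>i\<in>I. (u i)\<^sup>2) = (\<Sum>i\<in>I \<inter> Z. (g i)\<^sup>2) + (\<Sum>i\<in>I - Z. (f i)\<^sup>2)"
      by (subst split) (auto simp: u_def intro!: arg_cong2[where f = "(+)"] sum.cong)
    moreover have "(\<Sum>i\<in>I. (u i)\<^sup>2 * (x i - v)) = (\<Sum>i\<in>I - Z. (f i)\<^sup>2 * (x i - v))"
      by (subst split) (auto simp: u_def Z_def intro!: sum.cong)
    ultimately have "square_zero_sum (int p) x I"
      using f g by (intro square_zero_sum_translate[where u = u and c = v]) (auto simp: u_def)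
    then show ?thesis using I by blast
  qed
qed

text \<open>The difference of two distinct squares among 1, 4, 9 is 3, 5 or 8 up to sign, hence a
  unit. So each nonvanishing condition on a shifted sum excludes at most one of the weights 1, 4,
  9.\<close>

lemma unit_square_shift_inj:
  fixes p d s a b :: int
  assumes p: "prime p" "p > 5" and "\<not> p dvd d" and "a \<in> {1, 2, 3}" "b \<in> {1, 2, 3}"
    and d: "p dvd s + a\<^sup>2 * d" "p dvd s + b\<^sup>2 * d"
  shows "a = b"
proof (rule ccontr)
  assume "a \<noteq> b"
  have "p dvd (a\<^sup>2 - b\<^sup>2) * d" using dvd_diff[OF d] by (simp add: algebra_simps)
  then have "p dvd a\<^sup>2 - b\<^sup>2" using p assms(3) by (simp add: prime_dvd_mult_iff)
  then have "p dvd 3 \<or> p dvd 5 \<or> p dvd 8"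
    using assms(4,5) \<open>a \<noteq> b\<close> dvd_minus_iff[of p 3] dvd_minus_iff[of p 5] dvd_minus_iff[of p 8] by auto
  then show False using not_prime_dvd_numeral[OF p] by blast
qed

text \<open>Two equal terms contribute to the weight sum any unit we like, so the remaining weights only have
  to keep both \<open>\<Sum>a\<^sub>i(x\<^sub>i - u)\<close> and \<open>\<Sum>a\<^sub>i(x\<^sub>i - v)\<close> nonzero; varying one of them suffices.\<close>

lemma square_zero_sum_two_pairs:
  fixes p :: nat and x :: "'a \<Rightarrow> int"
  assumes p: "prime p" "p > 5" and J: "finite J" "card J = p + 2" and x: "x ` J \<subseteq> {0..<int p}"
    and i: "i1 \<in> J" "i2 \<in> J" "i1 \<noteq> i2" "x i1 = u" "x i2 = u"
    and j: "j1 \<in> J" "j2 \<in> J" "j1 \<noteq> j2" "x j1 = v" "x j2 = v" and uv: "u \<noteq> v"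
    and other: "\<And>k. k \<in> J - {i1, i2, j1, j2} \<Longrightarrow> x k \<noteq> u \<and> x k \<noteq> v"
  shows "\<exists>I\<subseteq>J. card I = p \<and> square_zero_sum (int p) x I"
proof -
  have pp: "prime (int p)" "int p > 5" using p by auto
  have c4: "card {i1, i2, j1, j2} = 4"
  proof -
    have "i1 \<noteq> j1" "i1 \<noteq> j2" "i2 \<noteq> j1" "i2 \<noteq> j2" using i j uv by auto
    then show ?thesis using i j by simp
  qed
  obtain I where I: "{i1, i2, j1, j2} \<subseteq> I" "I \<subseteq> J" "card I = p"
    using exists_subset_between[of "{i1, i2, j1, j2}" p J] J p i j c4 by auto
  have fI: "finite I" using I J finite_subset by blast
  have "card (I - {i1, i2, j1, j2}) = p - 4" using card_Diff_subset[OF _ I(1)] c4 I by simp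
  \<comment> \<open>Since p > 5, a fifth index \<open>k\<close> exists; its weight is the one that
    varies.\<close>
  then have "I - {i1, i2, j1, j2} \<noteq> {}" using p by (intro notI) simp
  then obtain k where k: "k \<in> I - {i1, i2, j1, j2}" by blast
  define R where "R = I - {i1, i2, j1, j2} - {k}"
  have I_eq: "I = insert i1 (insert i2 (insert j1 (insert j2 (insert k R))))"
    and R: "finite R" "i1 \<notin> R" "i2 \<notin> R" "j1 \<notin> R" "j2 \<notin> R" "k \<notin> R"
    using I k fI by (auto simp: R_def)
  have ne: "i1 \<noteq> j1" "i1 \<noteq> j2" "i2 \<noteq> j1" "i2 \<noteq> j2" "k \<noteq> i1" "k \<noteq> i2" "k \<noteq> j1" "k \<noteq> j2"
    using i j uv k by auto
  have "u \<in> x ` J" "v \<in> x ` J" "x k \<in> x ` J" using i j k I by auto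
  then have mem: "u \<in> {0..<int p}" "v \<in> {0..<int p}" "x k \<in> {0..<int p}" using x by blast+
  have xk: "x k \<noteq> u" "x k \<noteq> v" using other k I by auto
  have nd: "\<not> int p dvd x k - u" "\<not> int p dvd x k - v" "\<not> int p dvd u - v" "\<not> int p dvd v - u"
    using not_dvd_diff_residues mem xk uv by auto
  \<comment> \<open>The contribution of \<open>R\<close>, whose weights are all 1, when
    \<open>c\<close> is the origin.\<close>
  define s where "s c = (\<Sum>l\<in>R. x l - c)" for c
  \<comment> \<open>Each of the two conditions fails for at most one \<open>w\<close>, so one of the
    three candidates satisfies both.\<close>
  have "\<exists>w\<in>{1, 2, 3}. \<not> int p dvd s u + w\<^sup>2 * (x k - u) \<and> \<not> int p dvd s v + w\<^sup>2 * (x k - v)"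
  proof (rule ccontr)
    assume *: "\<not> ?thesis"
    have "w = w'" if "w \<in> {1, 2, 3}" "w' \<in> {1, 2, 3}"
      "int p dvd s u + w\<^sup>2 * (x k - u)" "int p dvd s u + w'\<^sup>2 * (x k - u)" for w w'
      using unit_square_shift_inj[OF pp nd(1) that] .
    moreover have "w = w'" if "w \<in> {1, 2, 3}" "w' \<in> {1, 2, 3}"
      "int p dvd s v + w\<^sup>2 * (x k - v)" "int p dvd s v + w'\<^sup>2 * (x k - v)" for w w'
      using unit_square_shift_inj[OF pp nd(2) that] .
    moreover have "(1::int) \<in> {1, 2, 3}" "(2::int) \<in> {1, 2, 3}" "(3::int) \<in> {1, 2, 3}"
      "(1::int) \<noteq> 2" "(1::int) \<noteq> 3" "(2::int) \<noteq> 3" by auto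
    ultimately show False using * by metis
  qed
  then obtain w where "w \<in> {1, 2, 3}"
    "\<not> int p dvd s u + w\<^sup>2 * (x k - u)" "\<not> int p dvd s v + w\<^sup>2 * (x k - v)" by blast
  then have w: "w \<in> {1, 2, 3}"
    "\<not> int p dvd - (s u + w\<^sup>2 * (x k - u))" "\<not> int p dvd - (s v + w\<^sup>2 * (x k - v))"
    unfolding dvd_minus_iff by blast+
  have one: "\<not> int p dvd 1" using pp(1) not_prime_unit by blast
  have wu: "\<not> int p dvd w"
  proof -
    have "w = 1 \<or> w = 2 \<or> w = 3" using w(1) by simp
    then show ?thesis using not_prime_dvd_numeral(1,2)[OF pp] one by blast
  qed
  \<comment> \<open>With origin \<open>u\<close> the pair \<open>i1\<close>, \<open>i2\<close>
    vanishes and only the weights of \<open>j1\<close>, \<open>j2\<close> are left to choose; with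
    origin \<open>v\<close> the roles are exchanged. The two equations are therefore solved
    independently.\<close>
  obtain a b where ab: "\<not> int p dvd a" "\<not> int p dvd b"
    "int p dvd (v - u) * a\<^sup>2 + (v - u) * b\<^sup>2 - (- (s u + w\<^sup>2 * (x k - u)))"
    using ex_binary_unit_square_sum[OF pp nd(4) nd(4) w(2)] .
  obtain c d where cd: "\<not> int p dvd c" "\<not> int p dvd d"
    "int p dvd (u - v) * c\<^sup>2 + (u - v) * d\<^sup>2 - (- (s v + w\<^sup>2 * (x k - v)))"
    using ex_binary_unit_square_sum[OF pp nd(3) nd(3) w(3)] .
  define f where "f l = (if l = i1 then c else if l = i2 then d else if l = j1 then a
    else if l = j2 then b else if l = k then w else 1)" for l
  have fu: "\<not> int p dvd f l" for l
    unfolding f_def using ab(1,2) cd(1,2) wu one by presburger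
  have fR: "(\<Sum>l\<in>R. (f l)\<^sup>2 * (x l - e)) = s e" for e
    unfolding s_def using R by (intro sum.cong) (auto simp: f_def)
  have sum_eq: "(\<Sum>l\<in>I. (f l)\<^sup>2 * (x l - e)) = c\<^sup>2 * (u - e) + (d\<^sup>2 * (u - e) + (a\<^sup>2 * (v - e) +
      (b\<^sup>2 * (v - e) + (w\<^sup>2 * (x k - e) + s e))))" for e
    unfolding I_eq using i j ne ne[symmetric] R fR[of e] by (simp add: f_def)
  have du: "int p dvd (\<Sum>l\<in>I. (f l)\<^sup>2 * (x l - u))"
    unfolding sum_eq using ab(3) by (simp add: algebra_simps)
  have dv: "int p dvd (\<Sum>l\<in>I. (f l)\<^sup>2 * (x l - v))"
    unfolding sum_eq using cd(3) by (simp add: algebra_simps)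
  \<comment> \<open>Vanishing for two origins already forces the weights to sum to zero, since
    \<open>v - u\<close> is a unit.\<close>
  have "(\<Sum>l\<in>I. (f l)\<^sup>2 * (x l - u)) - (\<Sum>l\<in>I. (f l)\<^sup>2 * (x l - v)) = (\<Sum>l\<in>I. (f l)\<^sup>2) * (v - u)"
    by (simp add: sum_distrib_right flip: sum_subtractf right_diff_distrib)
  then have "int p dvd (\<Sum>l\<in>I. (f l)\<^sup>2) * (v - u)" using dvd_diff[OF du dv] by simp
  then have "int p dvd (\<Sum>l\<in>I. (f l)\<^sup>2)" using pp nd(4) by (simp add: prime_dvd_mult_iff)
  then have "square_zero_sum (int p) x I" using square_zero_sum_translate[OF fu _ du] by blast
  then show ?thesis using I by blast
qed

lemma ex_square_zero_sum_large:
  fixes p :: nat and x :: "'a \<Rightarrow> int"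
  assumes p: "prime p" "p > 5" and J: "finite J" "card J = p + 2" and x: "x ` J \<subseteq> {0..<int p}"
  shows "\<exists>I\<subseteq>J. card I = p \<and> square_zero_sum (int p) x I"
proof (cases "\<exists>v. card {i \<in> J. x i = v} \<ge> 3")
  case True
  then show ?thesis using square_zero_sum_triple[OF p J x] by blast
next
  case False
  have no3: False if "i \<in> J" "j \<in> J" "k \<in> J" "i \<noteq> j" "i \<noteq> k" "j \<noteq> k" "x i = x j" "x i = x k" for i j k
  proof -
    have "card {i, j, k} \<le> card {l \<in> J. x l = x i}" using that J by (intro card_mono) auto
    moreover have "card {i, j, k} = 3" using that by simp
    ultimately show False using False by metis
  qed
  have not_inj: "\<not> inj_on x J'" if "J' \<subseteq> J" "card J' > p" for J'
  proof
    assume "inj_on x J'"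
    then have "card J' \<le> card {0..<int p}"
      using that x by (intro card_inj_on_le) auto
    then show False using that by simp
  qed
  obtain i1 i2 where i: "i1 \<in> J" "i2 \<in> J" "i1 \<noteq> i2" "x i1 = x i2"
    using not_inj[of J] J by (auto simp: inj_on_def)
  \<comment> \<open>Without \<open>i1\<close> there are still p + 1 indices for p residues. The
    second pair has a new value, as otherwise \<open>i1\<close>, \<open>j1\<close>,
    \<open>j2\<close> would be three equal terms.\<close>
  obtain j1 j2 where j: "j1 \<in> J - {i1}" "j2 \<in> J - {i1}" "j1 \<noteq> j2" "x j1 = x j2"
    using not_inj[of "J - {i1}"] J i(1) by (auto simp: inj_on_def)
  have uv: "x i1 \<noteq> x j1" using no3[of i1 j1 j2] i j by auto
  show ?thesis
  proof (rule square_zero_sum_two_pairs[OF p J x i(1-3) refl i(4)[symmetric] _ _ j(3) refl j(4)[symmetric] uv])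
    fix k assume k: "k \<in> J - {i1, i2, j1, j2}"
    show "x k \<noteq> x i1 \<and> x k \<noteq> x j1"
      using no3[of i1 i2 k] no3[of j1 j2 k] i j k by auto
  qed (use j in auto)
qed

text \<open>Modulo 3 the only unit square is 1, so three terms with sum zero are needed: three equal
  ones or 0, 1, 2. If no value occurs three times, five terms take at least three values, hence all
  residues.\<close>

lemma ex_square_zero_sum_3:
  fixes x :: "'a \<Rightarrow> int"
  assumes J: "finite J" "card J = 5" and x: "x ` J \<subseteq> {0..<3}"
  shows "\<exists>I\<subseteq>J. card I = 3 \<and> square_zero_sum 3 x I"
proof (cases "\<exists>v. card {i \<in> J. x i = v} \<ge> 3")
  case True
  then obtain v I where I: "I \<subseteq> {i \<in> J. x i = v}" "card I = 3"
    using obtain_subset_with_card_n by metis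
  then have "square_zero_sum (int 3) x I"
    by (intro square_zero_sum_const[where c = v]) auto
  then show ?thesis using I by auto
next
  case False
  have "card J = card (\<Union>v\<in>x ` J. {i \<in> J. x i = v})" by (rule arg_cong[where f = card]) auto
  also have "\<dots> \<le> (\<Sum>v\<in>x ` J. card {i \<in> J. x i = v})" using J by (intro card_UN_le) auto
  also have "\<dots> \<le> (\<Sum>v\<in>x ` J. 2)" using False by (intro sum_mono) (metis not_less_eq_eq numeral_2_eq_2 numeral_3_eq_3)
  finally have "card (x ` J) \<ge> card {0..<3::int}" using J by simp
  then have "x ` J = {0..<3}" using x by (intro card_seteq) auto
  then have "0 \<in> x ` J" "1 \<in> x ` J" "2 \<in> x ` J" by auto
  then obtain i j k where ijk: "i \<in> J" "j \<in> J" "k \<in> J" "x i = 0" "x j = 1" "x k = 2" by force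
  then have "i \<noteq> j" "i \<noteq> k" "j \<noteq> k" by auto
  with ijk show ?thesis
    by (intro exI[of _ "{i, j, k}"]) (auto simp: square_zero_sum_def intro!: exI[of _ "\<lambda>_. 1"])
qed

lemma ex_square_zero_sum:
  fixes p :: nat and x :: "'a \<Rightarrow> int"
  assumes p: "prime p" "odd p" "p \<noteq> 5" and J: "finite J" "card J = p + 2" and x: "x ` J \<subseteq> {0..<int p}"
  shows "\<exists>I\<subseteq>J. card I = p \<and> square_zero_sum (int p) x I"
proof (cases "p > 5")
  case True
  then show ?thesis using ex_square_zero_sum_large p(1) J x by blast
next
  case False
  then have "p < 5" using p by simp
  then have "p \<in> {0, 1, 2, 3, 4}" by auto
  then have "p = 3" using p by auto
  then show ?thesis using ex_square_zero_sum_3[OF J(1), of x] J x by simp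
qed

section \<open>Sequences\<close>

lemma mem_unit_squares_iff:
  assumes "prime p"
  shows "a \<in> unit_squares p \<longleftrightarrow> (\<exists>w. \<not> int p dvd w \<and> a = w\<^sup>2 mod int p)"
proof -
  interpret residues_prime p "residue_ring (int p)" by unfold_locales (use assms in auto)
  have p0: "p > 0" using assms prime_gt_0_nat by blast
  show ?thesis
  proof
    assume "a \<in> unit_squares p"
    then obtain w where "w \<in> {1..int p - 1}" "a = w\<^sup>2 mod int p"
      using p0 by (auto simp: unit_squares_def res_prime_units_eq res_mult_eq power2_eq_square of_nat_diff)
    then show "\<exists>w. \<not> int p dvd w \<and> a = w\<^sup>2 mod int p"
      by (intro exI[of _ w]) (auto dest: zdvd_imp_le)
  next
    assume "\<exists>w. \<not> int p dvd w \<and> a = w\<^sup>2 mod int p"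
    then obtain w where w: "\<not> int p dvd w" "a = w\<^sup>2 mod int p" by blast
    have "w mod int p \<in> Units (residue_ring (int p))"
      using w p_coprime_right_int m_gt_one by (intro mod_in_res_units) auto
    moreover have "a = (w mod int p) \<otimes>\<^bsub>residue_ring (int p)\<^esub> (w mod int p)"
      using w by (simp add: mult_cong power2_eq_square)
    ultimately show "a \<in> unit_squares p" by (auto simp: unit_squares_def)
  qed
qed

lemma Q_one_weighted_zero_sum_iff:
  assumes p: "prime p"
  shows "Q_one_weighted_zero_sum p xs \<longleftrightarrow> square_zero_sum (int p) (nth xs) {..<length xs}"
proof -
  interpret residues_prime p "residue_ring (int p)" by unfold_locales (use p in auto)
  let ?n = "length xs"
  have p0: "p > 0" using p prime_gt_0_nat by blast
  have weights: "(\<Oplus>\<^bsub>residue_ring (int p)\<^esub>i\<in>{..<?n}. f i) = (\<Sum>i<?n. g i) mod int p"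
    if "\<And>i. i < ?n \<Longrightarrow> f i = g i mod int p" for f g
  proof -
    have "(\<Oplus>\<^bsub>residue_ring (int p)\<^esub>i\<in>{..<?n}. f i) = (\<Oplus>\<^bsub>residue_ring (int p)\<^esub>i\<in>{..<?n}. g i mod int p)"
      using that by (intro finsum_cong') auto
    then show ?thesis by (simp add: sum_cong)
  qed
  have key: "(\<Oplus>\<^bsub>residue_ring (int p)\<^esub>i\<in>{..<?n}. as ! i \<otimes>\<^bsub>residue_ring (int p)\<^esub> xs ! i)
        = \<zero>\<^bsub>residue_ring (int p)\<^esub> \<longleftrightarrow> int p dvd (\<Sum>i<?n. (u i)\<^sup>2 * xs ! i)"
      "(\<Oplus>\<^bsub>residue_ring (int p)\<^esub>i\<in>{..<?n}. as ! i) = \<zero>\<^bsub>residue_ring (int p)\<^esub> \<longleftrightarrow>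
        int p dvd (\<Sum>i<?n. (u i)\<^sup>2)"
    if "\<And>i. i < ?n \<Longrightarrow> as ! i = (u i)\<^sup>2 mod int p" for as u
    using that by (auto simp: weights[where g = "\<lambda>i. (u i)\<^sup>2 * xs ! i"] weights[where g = "\<lambda>i. (u i)\<^sup>2"]
        res_mult_eq res_zero_eq mod_mult_left_eq dvd_eq_mod_eq_0)
  show ?thesis
  proof
    assume "Q_one_weighted_zero_sum p xs"
    then obtain as where as: "length as = ?n" "set as \<subseteq> unit_squares p"
      "(\<Oplus>\<^bsub>residue_ring (int p)\<^esub>i\<in>{..<?n}. as ! i \<otimes>\<^bsub>residue_ring (int p)\<^esub> xs ! i) = \<zero>\<^bsub>residue_ring (int p)\<^esub>"
      "(\<Oplus>\<^bsub>residue_ring (int p)\<^esub>i\<in>{..<?n}. as ! i) = \<zero>\<^bsub>residue_ring (int p)\<^esub>"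
      unfolding Q_one_weighted_zero_sum_def by blast
    have "\<forall>i\<in>{..<?n}. \<exists>w. \<not> int p dvd w \<and> as ! i = w\<^sup>2 mod int p"
    proof
      fix i assume "i \<in> {..<?n}"
      then have "as ! i \<in> unit_squares p" using as(1,2) nth_mem[of i as] by auto
      then show "\<exists>w. \<not> int p dvd w \<and> as ! i = w\<^sup>2 mod int p"
        unfolding mem_unit_squares_iff[OF p] .
    qed
    from bchoice[OF this]
    obtain u where "\<forall>i\<in>{..<?n}. \<not> int p dvd u i \<and> as ! i = (u i)\<^sup>2 mod int p" ..
    then show "square_zero_sum (int p) (nth xs) {..<?n}"
      unfolding square_zero_sum_def using as(3,4) key[of as u] by (intro exI[of _ u]) auto
  next
    assume "square_zero_sum (int p) (nth xs) {..<?n}"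
    then obtain u where u: "\<And>i. i < ?n \<Longrightarrow> \<not> int p dvd u i"
      "int p dvd (\<Sum>i<?n. (u i)\<^sup>2)" "int p dvd (\<Sum>i<?n. (u i)\<^sup>2 * xs ! i)"
      unfolding square_zero_sum_def by auto
    define as where "as = map (\<lambda>i. (u i)\<^sup>2 mod int p) [0..<?n]"
    have "\<And>i. i < ?n \<Longrightarrow> as ! i = (u i)\<^sup>2 mod int p" by (simp add: as_def)
    note key[OF this]
    moreover have "(u i)\<^sup>2 mod int p \<in> unit_squares p" if "i < ?n" for i
      using u(1)[OF that] mem_unit_squares_iff[OF p] by blast
    then have "set as \<subseteq> unit_squares p" by (auto simp: as_def)
    ultimately show "Q_one_weighted_zero_sum p xs"
      unfolding Q_one_weighted_zero_sum_def using u(2,3)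
      by (intro exI[of _ as]) (simp add: as_def)
  qed
qed

section \<open>From index sets back to subsequences\<close>

lemma square_zero_sum_reindex:
  assumes h: "bij_betw h A B" and "square_zero_sum p x B" and y: "\<And>i. i \<in> A \<Longrightarrow> y i = x (h i)"
  shows "square_zero_sum p y A"
proof -
  obtain u where u: "\<forall>i\<in>B. \<not> p dvd u i" "p dvd (\<Sum>i\<in>B. (u i)\<^sup>2)" "p dvd (\<Sum>i\<in>B. (u i)\<^sup>2 * x i)"
    using assms(2) unfolding square_zero_sum_def by blast
  have "(\<Sum>i\<in>A. (u (h i))\<^sup>2 * y i) = (\<Sum>i\<in>B. (u i)\<^sup>2 * x i)"
    using y by (subst sum.reindex_bij_betw[OF h, symmetric]) (auto intro: sum.cong)
  moreover have "(\<Sum>i\<in>A. (u (h i))\<^sup>2) = (\<Sum>i\<in>B. (u i)\<^sup>2)"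
    by (rule sum.reindex_bij_betw[OF h])
  moreover have "\<forall>i\<in>A. \<not> p dvd u (h i)" using u(1) bij_betwE[OF h] by blast
  ultimately show ?thesis
    unfolding square_zero_sum_def using u(2,3) by (intro exI[of _ "\<lambda>i. u (h i)"]) auto
qed

lemma nths_eq_map_nth_filter: "nths xs A = map (nth xs) (filter (\<lambda>i. i \<in> A) [0..<length xs])"
proof -
  have "zip xs [0..<length xs] = map (\<lambda>i. (xs ! i, i)) [0..<length xs]"
    by (rule nth_equalityI) auto
  then show ?thesis by (simp add: nths_def filter_map o_def)
qed

text \<open>The increasing list of the elements of \<open>I\<close> maps the positions of
  \<open>nths xs I\<close> bijectively onto \<open>I\<close>, and the weights are carried back along
  it.\<close>

lemma square_zero_sum_nths:
  assumes "I \<subseteq> {..<length xs}" and "square_zero_sum p (nth xs) I"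
  shows "square_zero_sum p (nth (nths xs I)) {..<length (nths xs I)}" and "length (nths xs I) = card I"
proof -
  define l where "l = filter (\<lambda>i. i \<in> I) [0..<length xs]"
  have l: "distinct l" "set l = I" using assms(1) by (auto simp: l_def)
  then show "length (nths xs I) = card I"
    by (simp add: nths_eq_map_nth_filter l_def[symmetric] flip: distinct_card)
  have "bij_betw (nth l) {..<length l} I" using l by (intro bij_betw_nth) auto
  moreover have "nths xs I = map (nth xs) l" by (simp add: nths_eq_map_nth_filter l_def)
  ultimately show "square_zero_sum p (nth (nths xs I)) {..<length (nths xs I)}"
    using square_zero_sum_reindex[OF _ assms(2), of "nth l" "{..<length l}"] by simp
qed

section \<open>The lower bound\<close>

lemma ex_quadratic_nonresidue:
  fixes p :: int
  assumes p: "prime p" "odd p"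
  obtains n where "0 < n" "n < p" "\<And>w. \<not> p dvd w\<^sup>2 - n"
proof -
  define f where "f w = w\<^sup>2 mod p" for w
  have p2: "p > 2" using p prime_ge_2_int[of p] by (cases "p = 2") auto
  \<comment> \<open>Squaring identifies 1 and p - 1, which differ as p > 2. Not being injective on
    the finite set of nonzero residues, it misses some \<open>n\<close>.\<close>
  have "(p - 1)\<^sup>2 - 1 = p * (p - 2)" by (simp add: power2_eq_square algebra_simps)
  then have "f (p - 1) = f 1" by (simp add: f_def mod_eq_dvd_iff)
  then have "\<not> inj_on f {1..p - 1}" using p2 unfolding inj_on_def by force
  then have "f ` {1..p - 1} \<noteq> {1..p - 1}" by (metis eq_card_imp_inj_on finite_atLeastAtMost_int)
  moreover have "f w \<in> {1..p - 1}" if "w \<in> {1..p - 1}" for w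
  proof -
    have "\<not> p dvd w" using that by (auto dest: zdvd_imp_le)
    then have "\<not> p dvd w\<^sup>2" using p by (simp add: prime_dvd_power_iff)
    then have "f w \<noteq> 0" by (simp add: f_def dvd_eq_mod_eq_0)
    moreover have "0 \<le> f w" "f w < p" using p2 by (auto simp: f_def)
    ultimately show ?thesis by simp
  qed
  ultimately obtain n where n: "n \<in> {1..p - 1}" "n \<notin> f ` {1..p - 1}" by blast
  have "\<not> p dvd w\<^sup>2 - n" for w
  proof
    assume "p dvd w\<^sup>2 - n"
    then have "w\<^sup>2 mod p = n mod p" by (simp add: mod_eq_dvd_iff)
    then have fn: "f (w mod p) = n" using n by (simp add: f_def power_mod)
    have "w mod p \<noteq> 0" using fn n by (auto simp: f_def)
    moreover have "0 \<le> w mod p" "w mod p < p" using p2 by auto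
    ultimately have "w mod p \<in> {1..p - 1}" by simp
    then show False using fn n by blast
  qed
  then show thesis using that[of n] n by simp
qed

lemma extremal_sequence:
  assumes p: "prime p" "odd p"
  obtains y where "0 < y" "y < int p"
    "\<And>ys. subseq ys (replicate (p - 1) 0 @ [1, y]) \<Longrightarrow> length ys = p \<Longrightarrow> \<not> Q_one_weighted_zero_sum p ys"
proof -
  have pp: "prime (int p)" "odd (int p)" using p by auto
  obtain n where n: "0 < n" "n < int p" "\<And>w. \<not> int p dvd w\<^sup>2 - n"
    using ex_quadratic_nonresidue[OF pp] by blast
  \<comment> \<open>The representative of \<open>-n\<close>: a relation a^2 + b^2 y = 0 with units
    a, b would make \<open>n\<close> the square of a / b.\<close>
  define y where "y = int p - n"
  have y: "0 < y" "y < int p" using n by (auto simp: y_def)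
  have y1: "\<not> int p dvd y" using y by (auto dest: zdvd_imp_le)
  have "\<not> Q_one_weighted_zero_sum p ys"
    if ys: "subseq ys (replicate (p - 1) 0 @ [1, y])" "length ys = p" for ys
  proof
    assume "Q_one_weighted_zero_sum p ys"
    then obtain u where u: "\<And>i. i < length ys \<Longrightarrow> \<not> int p dvd u i" "int p dvd (\<Sum>i<length ys. (u i)\<^sup>2 * ys ! i)"
      unfolding Q_one_weighted_zero_sum_iff[OF p(1)] square_zero_sum_def by auto
    obtain zs ws where zw: "ys = zs @ ws" "subseq zs (replicate (p - 1) 0)" "subseq ws [1, y]"
      using ys(1) by (auto simp: subseq_append_iff)
    obtain N where "zs = nths (replicate (p - 1) 0) N" using zw(2) by (auto simp: subseq_conv_nths)
    then have "set zs \<subseteq> {0}" using set_nths_subset[of "replicate (p - 1) 0" N] by auto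
    then have zs: "zs = replicate (length zs) 0"
      by (intro replicate_eqI) auto
    define m where "m = length zs"
    have ys_eq: "ys = replicate m 0 @ ws" using zw zs by (simp add: m_def)
    have "m \<le> p - 1" using list_emb_length[OF zw(2)] by (simp add: m_def)
    \<comment> \<open>There are only p - 1 zeros, so p terms must include 1 or \<open>y\<close>. The
      weighted sum reduces to the terms of \<open>ws\<close>, at positions \<open>m\<close> and
      possibly \<open>Suc m\<close>.\<close>
    then have "ws \<noteq> []" using ys ys_eq prime_gt_0_nat[OF p(1)] by auto
    moreover have "ws \<in> set (subseqs [1, y])" using zw(3) by (simp only: in_set_subseqs)
    ultimately consider "ws = [1, y]" | "ws = [1]" | "ws = [y]" by auto
    then show False
    proof cases
      case 1
      have "int p dvd (u m)\<^sup>2 + (u (Suc m))\<^sup>2 * y"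
        using u(2) by (simp add: ys_eq 1 nth_append)
      from dvd_diff[OF this dvd_triv_right, of "(u (Suc m))\<^sup>2"]
      have *: "int p dvd (u m)\<^sup>2 - (u (Suc m))\<^sup>2 * n"
        by (simp add: y_def algebra_simps)
      obtain b where b: "int p dvd u (Suc m) * b - 1"
        using ex_inverse_mod_prime[OF pp(1)] u(1)[of "Suc m"] by (auto simp: ys_eq 1)
      have "(u m * b)\<^sup>2 - n = ((u m)\<^sup>2 - (u (Suc m))\<^sup>2 * n) * b\<^sup>2 + (u (Suc m) * b - 1) * ((u (Suc m) * b + 1) * n)"
        by (simp add: power2_eq_square algebra_simps)
      then have "int p dvd (u m * b)\<^sup>2 - n" using * b by simp
      then show False using n(3) by blast
    next
      case 2
      have "int p dvd (u m)\<^sup>2" using u(2) by (simp add: ys_eq 2 nth_append)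
      moreover have "\<not> int p dvd u m" using u(1)[of m] by (auto simp: ys_eq 2)
      ultimately show False using pp prime_dvd_power by blast
    next
      case 3
      have "int p dvd (u m)\<^sup>2 * y" using u(2) by (simp add: ys_eq 3 nth_append)
      moreover have "\<not> int p dvd u m" using u(1)[of m] by (auto simp: ys_eq 3)
      ultimately show False using pp y1 prime_dvd_power by (metis prime_dvd_mult_iff)
    qed
  qed
  then show thesis using that y by blast
qed

theorem theorem2p14:
  fixes p :: nat
  assumes "prime p" and "odd p" and "p \<noteq> 5"
  shows "E_Q_one p = p + 2"
  unfolding E_Q_one_def
proof (rule Least_equality)
  interpret residues_prime p "residue_ring (int p)" by unfold_locales (use assms in auto)
  have carrier: "carrier (residue_ring (int p)) = {0..<int p}" by (auto simp: res_carrier_eq)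
  show "0 < p + 2 \<and> (\<forall>xs. length xs = p + 2 \<and> set xs \<subseteq> carrier (residue_ring (int p)) \<longrightarrow>
      (\<exists>ys. subseq ys xs \<and> length ys = p \<and> Q_one_weighted_zero_sum p ys))"
  proof (intro conjI allI impI)
    fix xs :: "int list"
    assume xs: "length xs = p + 2 \<and> set xs \<subseteq> carrier (residue_ring (int p))"
    then have "nth xs ` {..<length xs} \<subseteq> {0..<int p}"
      by (auto simp: carrier subset_iff)
    then obtain I where I: "I \<subseteq> {..<length xs}" "card I = p" "square_zero_sum (int p) (nth xs) I"
      using ex_square_zero_sum[OF assms, of "{..<length xs}" "nth xs"] xs by auto
    then show "\<exists>ys. subseq ys xs \<and> length ys = p \<and> Q_one_weighted_zero_sum p ys"
      using square_zero_sum_nths[OF I(1,3)]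
      by (intro exI[of _ "nths xs I"]) (auto simp: Q_one_weighted_zero_sum_iff[OF assms(1)] subseq_conv_nths)
  qed simp
  fix k
  assume k: "0 < k \<and> (\<forall>xs. length xs = k \<and> set xs \<subseteq> carrier (residue_ring (int p)) \<longrightarrow>
      (\<exists>ys. subseq ys xs \<and> length ys = p \<and> Q_one_weighted_zero_sum p ys))"
  obtain y where y: "0 < y" "y < int p"
    "\<And>ys. subseq ys (replicate (p - 1) 0 @ [1, y]) \<Longrightarrow> length ys = p \<Longrightarrow> \<not> Q_one_weighted_zero_sum p ys"
    using extremal_sequence[OF assms(1,2)] by blast
  \<comment> \<open>This has length p + 1. Its prefix of length k refutes every smaller k as well,
    since subsequences of a prefix are subsequences of \<open>zs\<close>.\<close>
  define zs where "zs = replicate (p - 1) 0 @ [1, y]"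
  have p1: "p > 1" using assms(1) prime_gt_1_nat by blast
  show "p + 2 \<le> k"
  proof (rule ccontr)
    assume "\<not> p + 2 \<le> k"
    then have "length (take k zs) = k" using p1 by (simp add: zs_def)
    moreover have "set (take k zs) \<subseteq> {0..<int p}"
      using set_take_subset[of k zs] p1 y by (auto simp: zs_def)
    ultimately obtain ys where ys: "subseq ys (take k zs)" "length ys = p" "Q_one_weighted_zero_sum p ys"
      using k carrier by metis
    have "subseq (take k zs) zs" by (intro prefix_imp_subseq take_is_prefix)
    then have "subseq ys zs" using ys(1) subseq_order.trans by blast
    then show False using y(3) ys unfolding zs_def by blast
  qed
qed

end
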